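(* For any non-negative integer $N$, $$\begin{aligned} G(1,1,2;2N)&=Rg(3,6,2;N)+2\,rtp(3,12,4;N-1),\\ G(1,1,2;2N+1)&=2\,Tp(3,6,1;N). \end{aligned}$$
   Context: $\mathbb{N}_0=\{0,1,2,\dots\}$. $t_n=n(n+1)/2$ (triangular numbers, $n\in\mathbb{N}_0$), $p_n=n(3n+1)/2$ (generalized pentagonal numbers, $n\in\mathbb{Z}$), $g_n=n(3n+2)$ (generalized octagonal numbers, $n\in\mathbb{Z}$). For positive integers $a_1,a_2,a_3$ and an integer $N$: $G(a_1,a_2,a_3;N)=|\{(l,m,n)\in\mathbb{Z}^3: N=a_1g_l+a_2g_m+a_3g_n\}|$; $Rg(a_1,a_2,a_3;N)=|\{(l,m,n)\in\mathbb{Z}^3: N=a_1l^2+a_2m^2+a_3g_n\}|$; $rtp(a_1,a_2,a_3;N)=|\{(l,m,n)\in\mathbb{Z}\times\mathbb{N}_0\times\mathbb{Z}: N=a_1l^2+a_2t_m+a_3p_n\}|$; $Tp(a_1,a_2,a_3;N)=|\{(l,m,n)\in\mathbb{N}_0^2\times\mathbb{Z}: N=a_1t_l+a_2t_m+a_3p_n\}|$. In particular these counts are $0$ when $N<0$. *)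

theory Defs
  imports Main
begin

(* The integer divisions by 2 below are exact. *)

definition triangular :: "nat \<Rightarrow> int" where
  "triangular n = int n * (int n + 1) div 2"

definition pentagonal :: "int \<Rightarrow> int" where
  "pentagonal n = n * (3 * n + 1) div 2"

definition octagonal :: "int \<Rightarrow> int" where
  "octagonal n = n * (3 * n + 2)"

(* The counts below are meant for positive a1, a2, a3 only: the solution sets are then finite,
   so that "card" is their true cardinality, and they are empty for negative N. *)

definition G :: "int \<Rightarrow> int \<Rightarrow> int \<Rightarrow> int \<Rightarrow> nat" where
  "G a1 a2 a3 N = card {(l :: int, m :: int, n :: int).
     N = a1 * octagonal l + a2 * octagonal m + a3 * octagonal n}"

definition Rg :: "int \<Rightarrow> int \<Rightarrow> int \<Rightarrow> int \<Rightarrow> nat" where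
  "Rg a1 a2 a3 N = card {(l :: int, m :: int, n :: int).
     N = a1 * l ^ 2 + a2 * m ^ 2 + a3 * octagonal n}"

definition rtp :: "int \<Rightarrow> int \<Rightarrow> int \<Rightarrow> int \<Rightarrow> nat" where
  "rtp a1 a2 a3 N = card {(l :: int, m :: nat, n :: int).
     N = a1 * l ^ 2 + a2 * triangular m + a3 * pentagonal n}"

definition Tp :: "int \<Rightarrow> int \<Rightarrow> int \<Rightarrow> int \<Rightarrow> nat" where
  "Tp a1 a2 a3 N = card {(l :: nat, m :: nat, n :: int).
     N = a1 * triangular l + a2 * triangular m + a3 * pentagonal n}"

end

theory Submission
  imports Defs
begin

text \<open>
  Everything rests on the substitution \<open>(l, m) = (s + d, s - d)\<close>, available when \<open>l + m\<close> is even,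
  and its half-integral analogue when \<open>l + m\<close> is odd. As \<open>octagonal l\<close> has the parity of \<open>l\<close>, the
  parity of the represented number decides which case occurs in \<open>G 1 1 2\<close>. In the even case the
  substitution leaves the form \<open>3 d\<^sup>2 + octagonal s + octagonal n\<close>, and a second application, split
  according to the parity of \<open>s + n\<close>, gives the two summands. In the odd case one is left with
  \<open>2 pentagonal k + octagonal n\<close>, which the rotation \<open>(k, n) \<mapsto> (k + n, n - k)\<close> turns into
  \<open>3 triangular + pentagonal\<close>. The reflection \<open>b \<mapsto> -1 - b\<close> fixes triangular numbers; it
  accounts for both factors 2.
\<close>

section \<open>Identities and bounds for polygonal numbers\<close>

lemma two_triangular: "2 * triangular n = int n * (int n + 1)"
  unfolding triangular_def by simp

lemma two_pentagonal: "2 * pentagonal n = n * (3 * n + 1)"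
  unfolding pentagonal_def by simp

lemma even_octagonal_iff [simp]: "even (octagonal n) \<longleftrightarrow> even n"
  unfolding octagonal_def by simp

lemma abs_le_octagonal: "\<bar>n\<bar> \<le> octagonal n"
proof -
  \<comment> \<open>These products are \<open>octagonal n - n\<close> and
    \<open>octagonal n + n\<close>; over the integers their two factors never have opposite
    signs.\<close>
  have "0 \<le> n * (3 * n + 1)" "0 \<le> n * (3 * n + 3)"
    by (cases "n \<ge> 0"; simp add: mult_nonpos_nonpos)+
  then show ?thesis
    unfolding octagonal_def by (simp add: algebra_simps abs_if)
qed

lemma abs_le_square: "\<bar>n\<bar> \<le> n ^ 2" for n :: int
  using self_le_power[of "\<bar>n\<bar>" 2] by (cases "n = 0") auto

lemma octagonal_add_even:
  "octagonal (s + d) + octagonal (s - d) = 2 * octagonal s + 6 * d ^ 2"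
  unfolding octagonal_def by (simp add: algebra_simps power2_eq_square)

text \<open>This is the identity of \<open>octagonal_add_even\<close> at
  \<open>s = - k - 1/2\<close>, \<open>d = b + 1/2\<close>. The sign of \<open>k\<close> makes
  \<open>octagonal s\<close> equal to \<open>2 * pentagonal k - 1/4\<close>.\<close>

lemma octagonal_add_odd:
  "octagonal (b - k) + octagonal (- k - 1 - b) = 4 * pentagonal k + 6 * (b * (b + 1)) + 1"
  using two_pentagonal[of k] unfolding octagonal_def by (simp add: algebra_simps)

text \<open>The cross terms of \<open>3 * (k + n)^2\<close> and \<open>3 * (n - k)^2\<close> cancel,
  and the linear terms \<open>3 * (k + n) + (n - k)\<close> add up to
  \<open>2 * k + 4 * n\<close>.\<close>

lemma two_pentagonal_add_octagonal:
  "2 * (2 * pentagonal k + octagonal n) = 3 * ((k + n) * (k + n + 1)) + 2 * pentagonal (n - k)"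
  using two_pentagonal[of k] two_pentagonal[of "n - k"]
  unfolding octagonal_def by (simp add: algebra_simps)

text \<open>The reflection has no integer fixed point, and exactly one of \<open>b\<close> and
  \<open>-1 - b\<close> is nonnegative, so the factor is exactly 2.\<close>

lemma card_fold_reflection:
  fixes P :: "'a \<Rightarrow> int \<Rightarrow> 'b \<Rightarrow> bool"
  shows "card {(x, b :: int, y). P x (b * (b + 1)) y}
       = 2 * card {(x, m :: nat, y). P x (2 * triangular m) y}"
proof -
  let ?A = "{(x, b :: int, y). P x (b * (b + 1)) y}"
  let ?B = "{(x, m :: nat, y). P x (2 * triangular m) y}"
  \<comment> \<open>The boolean records which half of the integers \<open>b\<close> came
    from.\<close>
  define f :: "'a \<times> int \<times> 'b \<Rightarrow> ('a \<times> nat \<times> 'b) \<times> bool" where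
    "f = (\<lambda>(x, b, y). ((x, nat (if b \<ge> 0 then b else - 1 - b), y), b \<ge> 0))"
  define g :: "('a \<times> nat \<times> 'b) \<times> bool \<Rightarrow> 'a \<times> int \<times> 'b" where
    "g = (\<lambda>((x, m, y), c). (x, if c then int m else - 1 - int m, y))"
  have "bij_betw f ?A (?B \<times> UNIV)"
    by (rule bij_betw_byWitness[where f' = g])
      (auto simp: f_def g_def two_triangular[unfolded mult.commute[of 2]] algebra_simps)
  then have "card ?A = card (?B \<times> (UNIV :: bool set))"
    by (rule bij_betw_same_card)
  then show ?thesis
    by (simp add: card_cartesian_product)
qed

section \<open>Even arguments of \<open>G\<close>\<close>

lemma G_even: "G 1 1 2 (2 * N) = card {(d, s, n). N = 3 * d ^ 2 + octagonal s + octagonal n}"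
proof -
  have "bij_betw (\<lambda>(d, s, n). (s + d, s - d, n))
      {(d, s, n). N = 3 * d ^ 2 + octagonal s + octagonal n}
      {(l, m, n). 2 * N = 1 * octagonal l + 1 * octagonal m + 2 * octagonal n}"
  proof (rule bij_betwI')
    fix y assume "y \<in> {(l, m, n). 2 * N = 1 * octagonal l + 1 * octagonal m + 2 * octagonal n}"
    then obtain l m n where y: "y = (l, m, n)"
      and N: "2 * N = octagonal l + octagonal m + 2 * octagonal n" by auto
    have "even (octagonal l + octagonal m)"
      using N by (metis dvd_add_left_iff dvd_triv_left)
    then have "even (l + m)" "even (l - m)" by auto
    then obtain s d where "l + m = 2 * s" "l - m = 2 * d" by (metis evenE)
    then have lm: "l = s + d" "m = s - d" by auto
    then have "N = 3 * d ^ 2 + octagonal s + octagonal n"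
      using N octagonal_add_even[of s d] by auto
    then show "\<exists>x\<in>{(d, s, n). N = 3 * d ^ 2 + octagonal s + octagonal n}.
        y = (case x of (d, s, n) \<Rightarrow> (s + d, s - d, n))"
      using y lm by (intro bexI[of _ "(d, s, n)"]) auto
  qed (auto simp: octagonal_add_even)
  then show ?thesis
    unfolding G_def by (rule bij_betw_same_card[symmetric])
qed

text \<open>Here \<open>octagonal_add_even\<close> acts on the pair \<open>(s, n)\<close> and leaves
  \<open>d\<close> alone.\<close>

lemma Rg_eq_card_even:
  "Rg 3 6 2 N = card {(d, s, n). N = 3 * d ^ 2 + octagonal s + octagonal n \<and> even (s + n)}"
proof -
  have "bij_betw (\<lambda>(l, m, n). (l, n + m, n - m))
      {(l, m, n). N = 3 * l ^ 2 + 6 * m ^ 2 + 2 * octagonal n}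
      {(d, s, n). N = 3 * d ^ 2 + octagonal s + octagonal n \<and> even (s + n)}"
  proof (rule bij_betwI')
    fix y assume "y \<in> {(d, s, n). N = 3 * d ^ 2 + octagonal s + octagonal n \<and> even (s + n)}"
    then obtain d s n where y: "y = (d, s, n)"
      and N: "N = 3 * d ^ 2 + octagonal s + octagonal n" and "even (s + n)" by auto
    then have "even (s + n)" "even (s - n)" by auto
    then obtain u v where "s + n = 2 * u" "s - n = 2 * v" by (metis evenE)
    then have sn: "s = u + v" "n = u - v" by auto
    then have "N = 3 * d ^ 2 + 6 * v ^ 2 + 2 * octagonal u"
      using N octagonal_add_even[of u v] by auto
    then show "\<exists>x\<in>{(l, m, n). N = 3 * l ^ 2 + 6 * m ^ 2 + 2 * octagonal n}.
        y = (case x of (l, m, n) \<Rightarrow> (l, n + m, n - m))"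
      using y sn by (intro bexI[of _ "(d, v, u)"]) auto
  qed (auto simp: octagonal_add_even add.assoc)
  then show ?thesis
    unfolding Rg_def by (rule bij_betw_same_card)
qed

lemma odd_sum_cases:
  fixes s n :: int
  assumes "odd (s + n)"
  obtains b k where "s = b - k" "n = - k - 1 - b"
proof -
  have "even (s - n - 1)" "even (s + n + 1)" using assms by auto
  then obtain b k where "s - n - 1 = 2 * b" "s + n + 1 = 2 * k" by (metis evenE)
  \<comment> \<open>The target equations give \<open>s + n + 1 = - 2 * k\<close>, hence the change
    of sign.\<close>
  then show ?thesis by (intro that[of b "- k"]) auto
qed

text \<open>The constant 1 in \<open>octagonal_add_odd\<close> causes the shift to
  \<open>N - 1\<close>, and \<open>6 * (b * (b + 1))\<close> folds to
  \<open>12 * triangular m\<close>.\<close>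

lemma two_rtp_eq_card_odd:
  "2 * rtp 3 12 4 (N - 1)
   = card {(d, s, n). N = 3 * d ^ 2 + octagonal s + octagonal n \<and> odd (s + n)}"
proof -
  have "bij_betw (\<lambda>(l, b, k). (l, b - k, - k - 1 - b))
      {(l, b :: int, k). N - 1 = 3 * l ^ 2 + 6 * (b * (b + 1)) + 4 * pentagonal k}
      {(d, s, n). N = 3 * d ^ 2 + octagonal s + octagonal n \<and> odd (s + n)}"
  proof (rule bij_betwI')
    fix x assume "x \<in> {(l, b :: int, k). N - 1 = 3 * l ^ 2 + 6 * (b * (b + 1)) + 4 * pentagonal k}"
    then obtain l b k where x: "x = (l, b, k)"
      and N: "N - 1 = 3 * l ^ 2 + 6 * (b * (b + 1)) + 4 * pentagonal k" by auto
    have "N = 3 * l ^ 2 + octagonal (b - k) + octagonal (- k - 1 - b)"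
      using N octagonal_add_odd[of b k] by linarith
    then show "(case x of (l, b, k) \<Rightarrow> (l, b - k, - k - 1 - b))
        \<in> {(d, s, n). N = 3 * d ^ 2 + octagonal s + octagonal n \<and> odd (s + n)}"
      using x by auto
  next
    fix y assume "y \<in> {(d, s, n). N = 3 * d ^ 2 + octagonal s + octagonal n \<and> odd (s + n)}"
    then obtain d s n where y: "y = (d, s, n)"
      and N: "N = 3 * d ^ 2 + octagonal s + octagonal n" and "odd (s + n)" by auto
    from this(3) obtain b k where sn: "s = b - k" "n = - k - 1 - b" by (rule odd_sum_cases)
    then have "N - 1 = 3 * d ^ 2 + 6 * (b * (b + 1)) + 4 * pentagonal k"
      using N octagonal_add_odd[of b k] by simp
    then show "\<exists>x\<in>{(l, b, k). N - 1 = 3 * l ^ 2 + 6 * (b * (b + 1)) + 4 * pentagonal k}.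
        y = (case x of (l, b, k) \<Rightarrow> (l, b - k, - k - 1 - b))"
      using y sn by (intro bexI[of _ "(d, b, k)"]) auto
  qed auto
  then have "card {(d, s, n). N = 3 * d ^ 2 + octagonal s + octagonal n \<and> odd (s + n)}
      = card {(l, b :: int, k). N - 1 = 3 * l ^ 2 + 6 * (b * (b + 1)) + 4 * pentagonal k}"
    by (rule bij_betw_same_card[symmetric])
  also have "\<dots> = 2 * rtp 3 12 4 (N - 1)"
    using card_fold_reflection[of "\<lambda>l t k. N - 1 = 3 * l ^ 2 + 6 * t + 4 * pentagonal k"]
    unfolding rtp_def by simp
  finally show ?thesis by simp
qed

text \<open>Finiteness lets \<open>card\<close> add up over the two parity classes of
  \<open>s + n\<close>.\<close>

lemma finite_square_octagonal:
  "finite {(d, s, n). N = 3 * d ^ 2 + octagonal s + octagonal n}"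
proof (rule finite_subset)
  show "{(d, s, n). N = 3 * d ^ 2 + octagonal s + octagonal n}
      \<subseteq> {- N..N} \<times> {- N..N} \<times> {- N..N}"
  proof
    fix x assume "x \<in> {(d, s, n). N = 3 * d ^ 2 + octagonal s + octagonal n}"
    then obtain d s n where x: "x = (d, s, n)"
      and N: "N = 3 * d ^ 2 + octagonal s + octagonal n" by auto
    have "\<bar>d\<bar> \<le> N" "\<bar>s\<bar> \<le> N" "\<bar>n\<bar> \<le> N"
      using N abs_le_square[of d] abs_le_octagonal[of s] abs_le_octagonal[of n] by linarith+
    then show "x \<in> {- N..N} \<times> {- N..N} \<times> {- N..N}" using x by auto
  qed
qed simp

section \<open>Odd arguments of \<open>G\<close>\<close>

lemma G_odd_fold:
  "G 1 1 2 (2 * N + 1)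
   = 2 * card {(k, m :: nat, n). N = 2 * pentagonal k + 6 * triangular m + octagonal n}"
proof -
  have "bij_betw (\<lambda>(k, b, n). (b - k, - k - 1 - b, n))
      {(k, b :: int, n). N = 2 * pentagonal k + 3 * (b * (b + 1)) + octagonal n}
      {(l, m, n). 2 * N + 1 = 1 * octagonal l + 1 * octagonal m + 2 * octagonal n}"
  proof (rule bij_betwI')
    fix x assume "x \<in> {(k, b :: int, n). N = 2 * pentagonal k + 3 * (b * (b + 1)) + octagonal n}"
    then obtain k b n where x: "x = (k, b, n)"
      and N: "N = 2 * pentagonal k + 3 * (b * (b + 1)) + octagonal n" by auto
    have "2 * N + 1 = 1 * octagonal (b - k) + 1 * octagonal (- k - 1 - b) + 2 * octagonal n"
      using N octagonal_add_odd[of b k] by linarith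
    then show "(case x of (k, b, n) \<Rightarrow> (b - k, - k - 1 - b, n))
        \<in> {(l, m, n). 2 * N + 1 = 1 * octagonal l + 1 * octagonal m + 2 * octagonal n}"
      using x by simp
  next
    fix y assume "y \<in> {(l, m, n). 2 * N + 1 = 1 * octagonal l + 1 * octagonal m + 2 * octagonal n}"
    then obtain l m n where y: "y = (l, m, n)"
      and N: "2 * N + 1 = octagonal l + octagonal m + 2 * octagonal n" by auto
    have "odd (octagonal l + octagonal m)"
      using N by presburger
    then have "odd (l + m)" by simp
    then obtain b k where lm: "l = b - k" "m = - k - 1 - b" by (rule odd_sum_cases)
    then have "N = 2 * pentagonal k + 3 * (b * (b + 1)) + octagonal n"
      using N octagonal_add_odd[of b k] by simp
    then show "\<exists>x\<in>{(k, b, n). N = 2 * pentagonal k + 3 * (b * (b + 1)) + octagonal n}.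
        y = (case x of (k, b, n) \<Rightarrow> (b - k, - k - 1 - b, n))"
      using y lm by (intro bexI[of _ "(k, b, n)"]) auto
  qed auto
  then have "G 1 1 2 (2 * N + 1)
      = card {(k, b :: int, n). N = 2 * pentagonal k + 3 * (b * (b + 1)) + octagonal n}"
    unfolding G_def by (rule bij_betw_same_card[symmetric])
  also have "\<dots> = 2 * card {(k, m :: nat, n).
      N = 2 * pentagonal k + 6 * triangular m + octagonal n}"
    using card_fold_reflection[of "\<lambda>k t n. N = 2 * pentagonal k + 3 * t + octagonal n"] by simp
  finally show ?thesis .
qed

text \<open>
  The rotation only reaches pairs \<open>(l, n)\<close> of integers with \<open>l + n\<close> even. Since \<open>l \<mapsto> -1 - l\<close>
  changes the parity of \<open>l\<close>, exactly one of the two preimages of each triangular index qualifies.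
\<close>

lemma Tp_eq_card:
  "Tp 3 6 1 N = card {(k, m :: nat, n). N = 2 * pentagonal k + 6 * triangular m + octagonal n}"
proof -
  let ?A = "{(k, m :: nat, n). N = 2 * pentagonal k + 6 * triangular m + octagonal n}"
  let ?B = "{(l, m, n). N = 3 * triangular l + 6 * triangular m + 1 * pentagonal n}"
  define f :: "int \<times> nat \<times> int \<Rightarrow> nat \<times> nat \<times> int" where
    "f = (\<lambda>(k, m, n). (nat (if k + n \<ge> 0 then k + n else - 1 - (k + n)), m, n - k))"
  \<comment> \<open>\<open>r l n\<close> is the one of \<open>l\<close> and \<open>-1 - l\<close>
    that has the parity of \<open>n\<close>, so the halves in \<open>g\<close> are exact.\<close>
  define r :: "nat \<Rightarrow> int \<Rightarrow> int" where
    "r l n = (if even (int l + n) then int l else - 1 - int l)" for l n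
  define g :: "nat \<times> nat \<times> int \<Rightarrow> int \<times> nat \<times> int" where
    "g = (\<lambda>(l, m, n). ((r l n - n) div 2, m, (r l n + n) div 2))"
  have r: "even (r l n - n)" "even (r l n + n)" for l n
    by (auto simp: r_def)
  have rt: "r l n * (r l n + 1) = 2 * triangular l" for l n
    unfolding two_triangular by (simp add: r_def algebra_simps)
  have "bij_betw f ?A ?B"
  proof (rule bij_betw_byWitness[where f' = g])
    show "\<forall>x\<in>?A. g (f x) = x"
    proof clarify
      fix k n :: int and m :: nat
      \<comment> \<open>The sum \<open>k + n\<close> has the parity of \<open>n - k\<close>, so
        \<open>r\<close> selects it rather than its reflection.\<close>
      have "r (nat (if k + n \<ge> 0 then k + n else - 1 - (k + n))) (n - k) = k + n"
        unfolding r_def by auto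
      then show "g (f (k, m, n)) = (k, m, n)"
        by (simp add: f_def g_def)
    qed
    show "\<forall>y\<in>?B. f (g y) = y"
    proof clarify
      fix l m :: nat and n :: int
      obtain k n' where kn: "r l n - n = 2 * k" "r l n + n = 2 * n'"
        using r by (metis evenE)
      then have sum: "k + n' = r l n" and diff: "n' - k = n" by auto
      have "nat (if k + n' \<ge> 0 then k + n' else - 1 - (k + n')) = l"
        unfolding sum by (simp add: r_def)
      moreover have "g (l, m, n) = (k, m, n')"
        using kn by (simp add: g_def)
      ultimately show "f (g (l, m, n)) = (l, m, n)"
        using diff by (simp add: f_def)
    qed
    show "f ` ?A \<subseteq> ?B"
    proof (rule image_subsetI)
      fix x assume "x \<in> ?A"
      then obtain k m n where x: "x = (k, m, n)"
        and N: "N = 2 * pentagonal k + 6 * triangular m + octagonal n" by auto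
      define l where "l = nat (if k + n \<ge> 0 then k + n else - 1 - (k + n))"
      have "(k + n) * (k + n + 1) = 2 * triangular l"
        unfolding two_triangular by (simp add: l_def algebra_simps)
      then have "N = 3 * triangular l + 6 * triangular m + pentagonal (n - k)"
        using N two_pentagonal_add_octagonal[of k n] by simp
      then show "f x \<in> ?B"
        using x by (simp add: f_def l_def)
    qed
    show "g ` ?B \<subseteq> ?A"
    proof (rule image_subsetI)
      fix y assume "y \<in> ?B"
      then obtain l m n where y: "y = (l, m, n)"
        and N: "N = 3 * triangular l + 6 * triangular m + pentagonal n" by auto
      obtain k n' where kn: "r l n - n = 2 * k" "r l n + n = 2 * n'"
        using r by (metis evenE)
      then have "k + n' = r l n" "n' - k = n" by auto
      then have "N = 2 * pentagonal k + 6 * triangular m + octagonal n'"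
        using N two_pentagonal_add_octagonal[of k n'] rt[of l n] by simp
      then show "g y \<in> ?A"
        using y kn by (simp add: g_def)
    qed
  qed
  then show ?thesis
    unfolding Tp_def by (rule bij_betw_same_card[symmetric])
qed

theorem theorem5p9:
  fixes N :: int
  assumes "N \<ge> 0"
  shows "G 1 1 2 (2 * N) = Rg 3 6 2 N + 2 * rtp 3 12 4 (N - 1)
       \<and> G 1 1 2 (2 * N + 1) = 2 * Tp 3 6 1 N"
proof
  let ?S = "{(d, s, n). N = 3 * d ^ 2 + octagonal s + octagonal n}"
  let ?E = "{(d, s, n). N = 3 * d ^ 2 + octagonal s + octagonal n \<and> even (s + n)}"
  let ?O = "{(d, s, n). N = 3 * d ^ 2 + octagonal s + octagonal n \<and> odd (s + n)}"
  have "finite ?E" "finite ?O"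
    by (auto intro: finite_subset[OF _ finite_square_octagonal[of N]])
  moreover have "?S = ?E \<union> ?O" "?E \<inter> ?O = {}" by auto
  ultimately have "card ?S = card ?E + card ?O"
    by (simp add: card_Un_disjoint)
  then show "G 1 1 2 (2 * N) = Rg 3 6 2 N + 2 * rtp 3 12 4 (N - 1)"
    by (simp only: G_even Rg_eq_card_even two_rtp_eq_card_odd)
  show "G 1 1 2 (2 * N + 1) = 2 * Tp 3 6 1 N"
    by (simp only: G_odd_fold Tp_eq_card)
qed

end
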